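(* Let $\mathcal{F} = \{f, g\}$ be an iterated function system on $\mathbb{R}^2$ consisting of affine transformations satisfying the following conditions: (1) $f(x) = Ax + b_f$, where $b_f \in \mathbb{R}^2$, $\det(A) < 0$, and $A^2 = cI$ for some $c \in (0, 1)$. (2) $g(x) = Sx + b_g$, where $b_g \in \mathbb{R}^2$ and $S = \pm rI$ for some $r \in (0, 1)$. (3) $c + r \le 1$. (4) The respective fixed points $z_f$ and $z_g$ of $f$ and $g$ are distinct, and the attractor $K$ of $\mathcal{F}$ is not contained in a single $1$-dimensional line. Then $\mathcal{F}$ satisfies the open set condition.
   Context: $A$ and $S$ are real $2\times2$ matrices and $I$ is the $2\times 2$ identity matrix. The attractor $K$ of $\{f,g\}$ is the unique non-empty compact set $K\subset\mathbb{R}^2$ with $K=f(K)\cup g(K)$. The open set condition for $\{f,g\}$: there is a non-empty open set $U\subset\mathbb{R}^2$ with $f(U)\cup g(U)\subset U$ and $f(U)\cap g(U)=\emptyset$. *)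

theory Defs
  imports "HOL-Analysis.Analysis"
begin

text \<open>
  A non-empty compact set with \<open>K = f(K) \<union> g(K)\<close>. Uniqueness is not part of the predicate: for the
  systems considered here such a set exists and is unique (some iterate of the system is
  contracting), so the predicate singles out the attractor.
\<close>

definition is_attractor ::
    "('a::topological_space \<Rightarrow> 'a) \<Rightarrow> ('a \<Rightarrow> 'a) \<Rightarrow> 'a set \<Rightarrow> bool" where
  "is_attractor f g K \<longleftrightarrow> K \<noteq> {} \<and> compact K \<and> K = f ` K \<union> g ` K"

definition open_set_condition ::
    "('a::topological_space \<Rightarrow> 'a) \<Rightarrow> ('a \<Rightarrow> 'a) \<Rightarrow> bool" where
  "open_set_condition f g \<longleftrightarrow>
     (\<exists>U. U \<noteq> {} \<and> open U \<and> f ` U \<union> g ` U \<subseteq> U \<and> f ` U \<inter> g ` U = {})"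

end

theory Submission
  imports Defs
begin

text \<open>
  Put \<open>v = z_g - z_f\<close>. The vectors \<open>v\<close> and \<open>A v\<close> are linearly independent: if \<open>v\<close> were an
  eigenvector of \<open>A\<close>, both maps would preserve the line through the two fixed points and shrink,
  up to sign, an affine function that vanishes exactly on it, so that the attractor would lie in
  that line (\<open>wedge_eigenvector\<close>, \<open>attractor_subset_zero_set\<close>).

  Hence a linear functional \<open>\<mu>\<close> can be prescribed freely on \<open>v\<close> and \<open>A v\<close>. Take the coordinates
  \<open>q x = \<mu> (x - z_f)\<close> and \<open>p x = \<mu> (A (x - z_f))\<close>. Because \<open>A\<^sup>2 = c I\<close>, whatever \<open>\<mu>\<close> is, the map \<open>f\<close>
  reads \<open>(p, q) \<mapsto> (c q, p)\<close>: it turns a square \<open>(0, L)\<^sup>2\<close> into the left strip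
  \<open>(0, c L) \<times> (0, L)\<close>. The map \<open>g\<close> scales both coordinates by \<open>\<plusminus>r\<close> about the point
  \<open>(\<mu> (A v), \<mu> v)\<close>, and \<open>\<mu>\<close> is chosen so that it maps \<open>(0, L)\<^sup>2\<close> onto the lower right corner square
  \<open>((1 - r) L, L) \<times> (0, r L)\<close>. For \<open>S = r I\<close> this means that \<open>g\<close> fixes the vertex \<open>(L, 0)\<close>:
  \<open>\<mu> (A v) = 1\<close>, \<open>\<mu> v = 0\<close> and \<open>L = 1\<close>. For \<open>S = - r I\<close> it means \<open>\<mu> (A v) = 1\<close>, \<open>\<mu> v = r\<close> and
  \<open>L = 1 + r\<close>. As \<open>c + r \<le> 1\<close>, strip and corner square do not meet, and the open set condition holds
  with the preimage of the square (\<open>open_set_condition_square\<close>).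
\<close>

text \<open>
  The line \<open>p = (1 - r) * L\<close> separates the two images of the square: \<open>p (f x) = c * q x < c * L\<close>, and
  \<open>c * L \<le> (1 - r) * L\<close>.
\<close>

lemma open_set_condition_square:
  fixes f g :: "'a::topological_space \<Rightarrow> 'a" and p q :: "'a \<Rightarrow> real"
  assumes cont: "continuous_on UNIV p" "continuous_on UNIV q"
    and c: "0 < c" and L: "0 < L" and c_r: "c + r \<le> 1" and r: "0 < r"
    and pf: "\<And>x. p (f x) = c * q x" and qf: "\<And>x. q (f x) = p x"
    and pg: "\<And>x. p x \<in> {0<..<L} \<Longrightarrow> p (g x) \<in> {(1 - r) * L<..<L}"
    and qg: "\<And>x. q x \<in> {0<..<L} \<Longrightarrow> q (g x) \<in> {0<..<L}"
    and x0: "p x0 \<in> {0<..<L}" "q x0 \<in> {0<..<L}"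
  shows "open_set_condition f g"
proof -
  define U where "U = p -` {0<..<L} \<inter> q -` {0<..<L}"
  have "open U"
    unfolding U_def using cont by (intro open_Int open_vimage) auto
  have bounds: "0 < (1 - r) * L" "(1 - r) * L < L"
    using c c_r L r by auto
  have strip: "c * y < (1 - r) * L" "0 < c * y" "c * y < L" if "y \<in> {0<..<L}" for y
  proof -
    have "c * y < c * L" using that c by simp
    also have "\<dots> \<le> (1 - r) * L" using c_r L by (intro mult_right_mono) auto
    finally show "c * y < (1 - r) * L" .
    then show "c * y < L" using bounds(2) by (rule less_trans)
    show "0 < c * y" using that c by simp
  qed
  have fU: "p (f x) < (1 - r) * L" "f x \<in> U" if "x \<in> U" for x
    using that strip[of "q x"] pf qf by (auto simp: U_def)
  have gU: "(1 - r) * L < p (g x)" "g x \<in> U" if "x \<in> U" for x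
    using that pg[of x] qg[of x] bounds by (auto simp: U_def)
  have "f x \<noteq> g y" if "x \<in> U" "y \<in> U" for x y
    using fU(1)[OF that(1)] gU(1)[OF that(2)] by auto
  then have "f ` U \<inter> g ` U = {}" by auto
  moreover have "f ` U \<union> g ` U \<subseteq> U" using fU(2) gU(2) by auto
  moreover have "x0 \<in> U" using x0 by (simp add: U_def)
  ultimately show ?thesis
    unfolding open_set_condition_def using \<open>open U\<close> by (intro exI[of _ U]) auto
qed

text \<open>
  At a point of \<open>K\<close> where \<open>\<bar>h\<bar>\<close> is maximal, which is the image of some point of \<open>K\<close>, the
  contraction forces the maximum to vanish.
\<close>

lemma attractor_subset_zero_set:
  fixes h :: "'a::topological_space \<Rightarrow> real"
  assumes K: "is_attractor f g K" and cont: "continuous_on K h" and k: "k < 1" "l < 1"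
    and hf: "\<And>x. \<bar>h (f x)\<bar> = k * \<bar>h x\<bar>" and hg: "\<And>x. \<bar>h (g x)\<bar> = l * \<bar>h x\<bar>"
    and x: "x \<in> K"
  shows "h x = 0"
proof -
  have "compact K" "K \<noteq> {}" and K_eq: "K = f ` K \<union> g ` K"
    using K by (auto simp: is_attractor_def)
  then have "\<exists>m\<in>K. \<forall>y\<in>K. \<bar>h y\<bar> \<le> \<bar>h m\<bar>"
    by (intro continuous_attains_sup continuous_on_rabs cont)
  then obtain m where m: "m \<in> K" "\<And>y. y \<in> K \<Longrightarrow> \<bar>h y\<bar> \<le> \<bar>h m\<bar>"
    by auto
  then obtain y where y: "y \<in> K" "m = f y \<or> m = g y"
    using K_eq by blast
  then obtain \<kappa> where \<kappa>: "\<kappa> < 1" "\<bar>h m\<bar> = \<kappa> * \<bar>h y\<bar>"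
    using k hf hg by metis
  have "\<bar>h y\<bar> = 0"
  proof (rule ccontr)
    assume "\<bar>h y\<bar> \<noteq> 0"
    then have "\<kappa> * \<bar>h y\<bar> < 1 * \<bar>h y\<bar>"
      using \<kappa>(1) by (intro mult_strict_right_mono) auto
    then show False using m(2)[OF y(1)] \<kappa>(2) by simp
  qed
  then have "\<bar>h m\<bar> = 0" using \<kappa>(2) by simp
  then show ?thesis using m(2)[OF x] by simp
qed

definition wedge :: "real ^ 2 \<Rightarrow> real ^ 2 \<Rightarrow> real" where
  "wedge x y = x $ 1 * y $ 2 - x $ 2 * y $ 1"

lemma wedge_self [simp]: "wedge x x = 0"
  by (simp add: wedge_def)

lemma wedge_linear_right: "linear (wedge x)"
  by (rule linearI) (auto simp: wedge_def algebra_simps)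

lemma wedge_linear_left: "linear (\<lambda>x. wedge x y)"
  by (rule linearI) (auto simp: wedge_def algebra_simps)

lemma wedge_eq_inner: "wedge x y = vector [- (x $ 2), x $ 1] \<bullet> y"
  by (simp add: wedge_def inner_vec_def sum_2)

lemma wedge_matrix_vector_mult: "wedge (A *v x) (A *v y) = det A * wedge x y"
  by (simp add: wedge_def det_2 matrix_vector_mult_def sum_2 algebra_simps)

lemma wedge_eq_zero_imp_parallel:
  assumes "x \<noteq> 0" "wedge x y = 0"
  obtains k where "y = k *\<^sub>R x"
proof -
  have "x $ 1 \<noteq> 0 \<or> x $ 2 \<noteq> 0"
    using assms(1) by (auto simp: vec_eq_iff forall_2)
  then show ?thesis
  proof
    assume "x $ 1 \<noteq> 0"
    then have "y = (y $ 1 / x $ 1) *\<^sub>R x"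
      using assms(2) by (auto simp: wedge_def vec_eq_iff forall_2 field_simps)
    then show ?thesis by (rule that)
  next
    assume "x $ 2 \<noteq> 0"
    then have "y = (y $ 2 / x $ 2) *\<^sub>R x"
      using assms(2) by (auto simp: wedge_def vec_eq_iff forall_2 field_simps)
    then show ?thesis by (rule that)
  qed
qed

lemma linear_functional_prescribed:
  assumes "wedge x y \<noteq> 0"
  obtains \<mu> :: "real ^ 2 \<Rightarrow> real" where "linear \<mu>" "\<mu> x = s" "\<mu> y = t"
proof
  \<comment> \<open>Cramer's rule\<close>
  let ?\<mu> = "\<lambda>z. (s / wedge x y) * wedge z y + (t / wedge x y) * wedge x z"
  show "linear ?\<mu>"
    using linear_compose_add[OF linear_compose_scale_right[OF wedge_linear_left]
        linear_compose_scale_right[OF wedge_linear_right]]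
    by (simp only: real_scaleR_def)
  show "?\<mu> x = s" "?\<mu> y = t" using assms by auto
qed

text \<open>
  The second eigenvalue of \<open>A\<close> is \<open>- k\<close>, and it belongs to the functional \<open>wedge v\<close>, because
  \<open>k * wedge v (A x) = wedge (A v) (A x) = det A * wedge v x\<close> and \<open>det A = - c = - k\<^sup>2\<close>.
\<close>

lemma wedge_eigenvector:
  fixes A :: "real ^ 2 ^ 2"
  assumes det_A: "det A < 0" and A_sq: "A ** A = c *\<^sub>R mat 1" and c: "0 < c"
    and v: "v \<noteq> 0" "A *v v = k *\<^sub>R v"
  shows "k\<^sup>2 = c" "wedge v (A *v x) = - k * wedge v x"
proof -
  have "(k * k) *\<^sub>R v = A *v (A *v v)"
    by (simp add: v matrix_vector_mult_scaleR)
  also have "\<dots> = c *\<^sub>R v"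
    by (simp add: matrix_vector_mul_assoc A_sq scaleR_matrix_vector_assoc [symmetric])
  finally show k: "k\<^sup>2 = c" using v(1) by (simp add: power2_eq_square)
  have "det A * det A = det (A ** A)" by (simp add: det_mul)
  also have "\<dots> = c * c" by (simp add: A_sq det_2 mat_def)
  finally have "(det A)\<^sup>2 = c\<^sup>2" by (simp add: power2_eq_square)
  then have "det A = - c" using det_A c by (auto simp: power2_eq_iff)
  then have "wedge (A *v v) (A *v x) = - c * wedge v x"
    by (simp add: wedge_matrix_vector_mult)
  moreover have "wedge (A *v v) (A *v x) = k * wedge v (A *v x)"
    by (simp add: v wedge_def algebra_simps)
  ultimately have "k * wedge v (A *v x) = k * (- k * wedge v x)"
    using k by (simp add: power2_eq_square)
  moreover have "k \<noteq> 0" using k c by auto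
  ultimately show "wedge v (A *v x) = - k * wedge v x"
    by (simp only: mult_cancel_left) simp
qed

theorem theorem6p4:
  fixes f g :: "real ^ 2 \<Rightarrow> real ^ 2"
    and A S :: "real ^ 2 ^ 2"
    and b_f b_g z_f z_g :: "real ^ 2"
    and c r :: real
    and K :: "(real ^ 2) set"
  assumes f: "\<And>x. f x = A *v x + b_f"
    and det_A: "det A < 0"
    and c: "0 < c" "c < 1"
    and A_sq: "A ** A = c *\<^sub>R mat 1"
    and g: "\<And>x. g x = S *v x + b_g"
    and r: "0 < r" "r < 1"
    and S: "S = r *\<^sub>R mat 1 \<or> S = - (r *\<^sub>R mat 1)"
    and c_r: "c + r \<le> 1"
    and z_f: "f z_f = z_f"
    and z_g: "g z_g = z_g"
    and z_neq: "z_f \<noteq> z_g"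
    and K: "is_attractor f g K"
    and K_not_line: "\<not> (\<exists>L. affine L \<and> aff_dim L = 1 \<and> K \<subseteq> L)"
  shows "open_set_condition f g"
proof -
  define v where "v = z_g - z_f"
  have "v \<noteq> 0" using z_neq by (simp add: v_def)
  have AA: "A *v (A *v x) = c *\<^sub>R x" for x
    by (simp add: matrix_vector_mul_assoc A_sq scaleR_matrix_vector_assoc [symmetric])
  obtain s where s: "s = r \<or> s = - r" "\<And>x. S *v x = s *\<^sub>R x"
  proof -
    have "(r *\<^sub>R mat 1) *v x = r *\<^sub>R x" "(- (r *\<^sub>R mat 1)) *v x = (- r) *\<^sub>R x" for x :: "real ^ 2"
      by (simp_all add: vec_eq_iff forall_2 matrix_vector_mult_def sum_2 mat_def)
    then show ?thesis using S that by metis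
  qed
  have f_rel: "f x - z_f = A *v (x - z_f)" for x
  proof -
    have "f x - f z_f = A *v (x - z_f)" by (simp add: f matrix_vector_mult_diff_distrib)
    then show ?thesis by (simp only: z_f)
  qed
  have g_rel: "g x - z_f = s *\<^sub>R (x - z_f) + (1 - s) *\<^sub>R v" for x
  proof -
    have "g x - g z_g = s *\<^sub>R (x - z_g)" by (simp add: g s(2) scaleR_diff_right)
    then have "g x - z_g = s *\<^sub>R (x - z_g)" by (simp only: z_g)
    then show ?thesis by (simp add: v_def algebra_simps)
  qed

  have indep: "wedge v (A *v v) \<noteq> 0"
  proof
    assume "wedge v (A *v v) = 0"
    then obtain k where k: "A *v v = k *\<^sub>R v"
      using wedge_eq_zero_imp_parallel[OF \<open>v \<noteq> 0\<close>] by metis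
    note ev = wedge_eigenvector[OF det_A A_sq c(1) \<open>v \<noteq> 0\<close> k]
    have "\<bar>k\<bar> < 1" using ev(1) c(2) abs_square_less_1[of k] by simp
    define h where "h x = wedge v (x - z_f)" for x
    have cont: "continuous_on K h"
      unfolding h_def wedge_def by (intro continuous_intros)
    have hf: "\<bar>h (f x)\<bar> = \<bar>k\<bar> * \<bar>h x\<bar>" for x
      by (simp add: h_def f_rel ev(2) abs_mult)
    have hg: "\<bar>h (g x)\<bar> = r * \<bar>h x\<bar>" for x
    proof -
      have "h (g x) = s * h x"
        by (simp add: h_def g_rel linear_add[OF wedge_linear_right]
            linear_scale[OF wedge_linear_right])
      moreover have "\<bar>s\<bar> = r" using s(1) r by auto
      ultimately show ?thesis by (simp add: abs_mult)
    qed
    have h0: "h x = 0" if "x \<in> K" for x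
      by (rule attractor_subset_zero_set[OF K cont \<open>\<bar>k\<bar> < 1\<close> r(2) hf hg that])
    define a :: "real ^ 2" where "a = vector [- (v $ 2), v $ 1]"
    have "a \<noteq> 0"
      using \<open>v \<noteq> 0\<close> by (auto simp: a_def vec_eq_iff forall_2)
    let ?L = "{x. a \<bullet> x = a \<bullet> z_f}"
    have "affine ?L" "aff_dim ?L = 1"
      using \<open>a \<noteq> 0\<close> by (simp_all add: affine_hyperplane aff_dim_hyperplane)
    moreover have "K \<subseteq> ?L"
      using h0 by (auto simp: h_def wedge_eq_inner a_def inner_diff_right)
    ultimately show False using K_not_line by blast
  qed

  \<comment> \<open>\<open>(1, t)\<close> are the coordinates \<open>(p, q)\<close> of \<open>z_g\<close>: a vertex of the square if \<open>s = r\<close>, and a point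
    inside it if \<open>s = - r\<close>, where \<open>g\<close> turns the square by \<open>180\<close> degrees.\<close>
  define t where "t = (if s = r then 0 else r)"
  define L where "L = 1 + t"
  have t: "0 \<le> t" "t < 1" and L: "0 < L" using r by (auto simp: t_def L_def)
  obtain \<mu> where lin: "linear \<mu>" and \<mu>v: "\<mu> v = t" and \<mu>Av: "\<mu> (A *v v) = 1"
    using linear_functional_prescribed[OF indep] by metis
  note \<mu>_simps = linear_add[OF lin] linear_scale[OF lin]
  define p q where "p x = \<mu> (A *v (x - z_f))" and "q x = \<mu> (x - z_f)" for x
  have pg: "p (g x) = s * p x + (1 - s)" and qg: "q (g x) = s * q x + (1 - s) * t" for x
    by (simp_all add: p_def q_def g_rel matrix_vector_right_distrib matrix_vector_mult_scaleR
        \<mu>_simps \<mu>v \<mu>Av)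
  show ?thesis
  proof (rule open_set_condition_square)
    show "continuous_on UNIV p" "continuous_on UNIV q"
      unfolding p_def q_def
      by (intro linear_continuous_on_compose[OF _ lin]
          linear_continuous_on_compose[OF _ matrix_vector_mul_linear] continuous_intros)+
    show "p (f x) = c * q x" "q (f x) = p x" for x
      by (simp_all add: p_def q_def f_rel AA \<mu>_simps)
    show "p (g x) \<in> {(1 - r) * L<..<L}" if "p x \<in> {0<..<L}" for x
    proof -
      have "0 < r * p x" "r * p x < r * L" using that r by auto
      then show ?thesis using s(1) r by (auto simp: pg L_def t_def algebra_simps)
    qed
    show "q (g x) \<in> {0<..<L}" if "q x \<in> {0<..<L}" for x
    proof -
      have "0 < r * q x" "r * q x < r * L" using that r by auto
      moreover have "r * L < L" using r L by simp
      then have "r * q x < L" using \<open>r * q x < r * L\<close> by linarith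
      moreover have "r * r < 1" using r mult_strict_mono[of r 1 r 1] by simp
      ultimately show ?thesis using s(1) r by (auto simp: qg L_def t_def algebra_simps)
    qed
    have "c * t < 1" "0 \<le> c * t"
      using c t mult_strict_mono[of c 1 t 1] by auto
    \<comment> \<open>The midpoint of \<open>z_g\<close>, with coordinates \<open>(1, t)\<close>, and \<open>f z_g\<close>, with coordinates \<open>(c t, 1)\<close>.\<close>
    define x0 where "x0 = z_f + (1 / 2) *\<^sub>R (v + A *v v)"
    have "p x0 = (1 + c * t) / 2" "q x0 = (1 + t) / 2"
      by (simp_all add: p_def q_def x0_def matrix_vector_right_distrib matrix_vector_mult_scaleR
          AA \<mu>_simps \<mu>v \<mu>Av)
    then show "p x0 \<in> {0<..<L}" "q x0 \<in> {0<..<L}"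
      using t \<open>c * t < 1\<close> \<open>0 \<le> c * t\<close> by (auto simp: L_def)
  qed (use c r L c_r in auto)
qed

end
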